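(* Let $k$, $m$ and $s$ be positive integers with $s\le m+1$. Then for all integers $n\ge 0$: \begin{align*} p_{-(3^{k+m}-3b)/b}\left(3^{2s} n+3^{2s-1} r+\frac{3^{2s}-1}{8}\right)&\equiv 0 \pmod{3^{k+m-s+1}}, && r\in\{1,2\},\\ p_{-(5^{k+m}-3b)/b}\left(5^{2s} n+5^{2s-1} r+\frac{5^{2s}-1}{8}\right)&\equiv 0 \pmod{5^{k+m-s+1}}, && r\in\{1,2,3,4\},\\ p_{-(5^{k+m}-4b)/b}\left(5^{2s} n+5^{2s-1} r+\frac{5^{2s}-1}{6}\right)&\equiv 0 \pmod{5^{k+m-s+1}}, && r\in\{1,2,3,4\},\\ p_{-(7^{k+m}-3b)/b}\left(7^{2s} n+7^{2s-1} r+\frac{7^{2s}-1}{8}\right)&\equiv 0 \pmod{7^{k+m-s+1}}, && r\in\{1,2,\ldots,6\}, \end{align*} where in each congruence $b$ is any positive integer coprime to the modulus (i.e. to $3$, $5$, $5$, $7$ respectively).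
   Context: For a rational number $t\neq 0$, the rational numbers $p_t(n)$, $n\ge 0$, are defined by the formal power series identity $\sum_{n\ge 0}p_t(n)q^n=\prod_{j\ge 1}(1-q^j)^t$, where each factor $(1-q^j)^t$ is the binomial series with constant term $1$. For a prime $\ell$ not dividing the denominator of $t$, a congruence $p_t(N)\equiv 0\pmod{\ell^k}$ means that the numerator of $p_t(N)$, written as a reduced fraction, is divisible by $\ell^k$ (the denominator of $p_t(N)$ is then coprime to $\ell$). *)

theory Defs
  imports "HOL-Analysis.Analysis"
begin

text \<open>The factor $(1-q^j)^t$ with $j = i + 1$: the product is indexed by the naturals
  from $0$, whereas $j$ runs over the positive integers.\<close>

definition euler_factor :: "rat \<Rightarrow> nat \<Rightarrow> rat fps" where
  "euler_factor t i = fps_binomial t oo (- (fps_X ^ Suc i))"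

definition p_series :: "rat \<Rightarrow> rat fps" where
  "p_series t = (\<Prod>i. euler_factor t i)"

definition p_coeff :: "rat \<Rightarrow> nat \<Rightarrow> rat" where
  "p_coeff t n = fps_nth (p_series t) n"

text \<open>Divisibility of the numerator of the reduced fraction; for $M = l^e$ with $e > 0$ this forces the
  denominator to be coprime to $l$.\<close>

definition rat_cong_zero :: "rat \<Rightarrow> int \<Rightarrow> bool" where
  "rat_cong_zero x M \<longleftrightarrow> M dvd fst (quotient_of x)"

lemma euler_factor_nth_0 [simp]: "fps_nth (euler_factor t i) 0 = 1"
  by (simp add: euler_factor_def)

lemma euler_factor_nth_eq_0:
  assumes "0 < n" "n \<le> i"
  shows "fps_nth (euler_factor t i) n = 0"
proof -
  have "fps_nth ((- (fps_X ^ Suc i) :: rat fps) ^ k) n = 0" if "k \<le> n" for k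
  proof (cases k)
    case 0
    then show ?thesis using assms by simp
  next
    case (Suc l)
    have "(- (fps_X ^ Suc i) :: rat fps) ^ k = (- 1) ^ k * fps_X ^ (Suc i * k)"
      by (subst power_minus) (simp only: power_mult)
    also have "(- 1 :: rat fps) ^ k = fps_const ((- 1) ^ k)"
      by (metis fps_const_neg fps_const_1_eq_1 fps_const_power)
    finally have "(- (fps_X ^ Suc i) :: rat fps) ^ k = fps_const ((- 1) ^ k) * fps_X ^ (Suc i * k)" .
    moreover have "n < Suc i * k"
      using assms Suc by auto
    ultimately show ?thesis
      by (simp only: fps_mult_left_const_nth fps_X_power_nth) simp
  qed
  then show ?thesis
    by (simp add: euler_factor_def fps_compose_nth)
qed

lemma euler_partial_prod_nth_Suc:
  assumes "n \<le> Suc N"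
  shows "fps_nth (\<Prod>i\<le>Suc N. euler_factor t i) n = fps_nth (\<Prod>i\<le>N. euler_factor t i) n"
proof -
  have "fps_nth (\<Prod>i\<le>Suc N. euler_factor t i) n =
        (\<Sum>k=0..n. fps_nth (\<Prod>i\<le>N. euler_factor t i) k * fps_nth (euler_factor t (Suc N)) (n - k))"
    by (simp add: fps_mult_nth)
  also have "\<dots> = (\<Sum>k=0..n. if k = n then fps_nth (\<Prod>i\<le>N. euler_factor t i) k else 0)"
    using assms by (intro sum.cong) (auto simp: euler_factor_nth_eq_0)
  finally show ?thesis by simp
qed

lemma euler_partial_prod_nth:
  assumes "n \<le> N"
  shows "fps_nth (\<Prod>i\<le>N. euler_factor t i) n = fps_nth (\<Prod>i\<le>n. euler_factor t i) n"
  using assms by (induction N rule: dec_induct) (simp, metis euler_partial_prod_nth_Suc le_SucI)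

text \<open>\<^const>\<open>prodinf\<close> is only meaningful for convergent products; here the product converges in
  the topology of formal power series, for every exponent.\<close>

lemma euler_factor_has_prod: "euler_factor t has_prod p_series t"
proof -
  define P where "P = Abs_fps (\<lambda>n. fps_nth (\<Prod>i\<le>n. euler_factor t i) n)"
  have "(\<lambda>N. \<Prod>i\<le>N. euler_factor t i) \<longlonglongrightarrow> P"
  proof (rule tendsto_fpsI)
    fix n
    show "\<forall>\<^sub>F N in sequentially. fps_nth (\<Prod>i\<le>N. euler_factor t i) n = fps_nth P n"
      using eventually_ge_at_top[of n]
      by eventually_elim (unfold P_def fps_nth_Abs_fps, rule euler_partial_prod_nth)
  qed
  moreover have "fps_nth P 0 = 1"
    by (simp add: P_def)
  then have "P \<noteq> 0" by auto
  ultimately have "euler_factor t has_prod P"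
    by (simp add: has_prod_def raw_has_prod_def)
  then show ?thesis
    using has_prod_unique p_series_def by metis
qed

lemma p_coeff_eq_partial_prod:
  "p_coeff t n = fps_nth (\<Prod>i\<le>n. euler_factor t i) n"
proof -
  have "(\<lambda>N. \<Prod>i\<le>N. euler_factor t i) \<longlonglongrightarrow> p_series t"
    using euler_factor_has_prod by (rule has_prod_imp_tendsto)
  then have "\<forall>\<^sub>F N in sequentially. fps_nth (\<Prod>i\<le>N. euler_factor t i) n = p_coeff t n"
    unfolding tendsto_fps_iff p_coeff_def by blast
  then obtain N0 where "\<And>N. N \<ge> N0 \<Longrightarrow> fps_nth (\<Prod>i\<le>N. euler_factor t i) n = p_coeff t n"
    unfolding eventually_sequentially by blast
  from this[of "max n N0"] show ?thesis
    using euler_partial_prod_nth[of n "max n N0" t] by simp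
qed

end

theory Submission
  imports Defs "HOL-Number_Theory.Cong"
begin

text \<open>Write the series as \<open>E ^ d * F\<close> with $E = \prod_j (1 - q^j)$, \<open>d \<in> {3, 4}\<close> and
  $F = E^{-\ell^K/b}$, \<open>K = k + m\<close>. Since \<open>k (c choose k) = c (c - 1 choose k - 1)\<close>, the coefficient
  $a_M$ of \<open>F\<close> satisfies $\ell^K \mid M a_M$. By Jacobi, $E^3 = \sum_i (-1)^i (2i+1) q^{i(i+1)/2}$, so for
  \<open>d = 3\<close> the $N$-th coefficient is a sum of terms $\pm y a_M$ with $8N + 1 = y^2 + 8M$. The left-hand
  side has $\ell$-adic valuation exactly \<open>2s - 1\<close>, which is odd, so \<open>M\<close> has valuation
  $\min(2v(y), 2s - 1)$; in either case $v(y) + K - v(M) \ge K - s + 1$. For \<open>d = 4\<close> one further factor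
  \<open>E\<close>, supported on exponents $j$ with $24j + 1 = x^2$ by the pentagonal number theorem, replaces
  $y^2$ by $x^2 + 3y^2$, whose $5$-adic valuation is even as well. Both theta identities come from the
  finite $q$-binomial theorem.\<close>

section \<open>Divisibility in the localisation of the integers at a prime\<close>

text \<open>For prime \<open>p\<close> this is membership of \<open>x\<close> in
  \<open>p ^ e\<close> times the localisation of the integers at \<open>p\<close>. The denominator
  is cleared by some unit \<open>b\<close> instead of being read off a reduced fraction, so sums and
  products require no cancellation.\<close>

definition loc_dvd :: "int \<Rightarrow> nat \<Rightarrow> rat \<Rightarrow> bool" where
  "loc_dvd p e x \<longleftrightarrow> (\<exists>a b. \<not> p dvd b \<and> of_int b * x = of_int (p ^ e * a))"

lemma loc_dvd_of_int:
  assumes "prime p" "p ^ e dvd a"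
  shows "loc_dvd p e (of_int a)"
proof -
  obtain c where "a = p ^ e * c" using assms(2) by blast
  then show ?thesis
    unfolding loc_dvd_def using assms(1) by (intro exI[of _ c] exI[of _ 1]) auto
qed

lemma loc_dvd_0 [simp]: "prime p \<Longrightarrow> loc_dvd p e 0"
  using loc_dvd_of_int[of p e 0] by simp

lemma loc_dvd_add:
  assumes p: "prime p" and "loc_dvd p e x" "loc_dvd p e y"
  shows "loc_dvd p e (x + y)"
proof -
  obtain a b c d where *: "\<not> p dvd b" "of_int b * x = of_int (p ^ e * a)"
    "\<not> p dvd d" "of_int d * y = of_int (p ^ e * c)"
    using assms(2,3) unfolding loc_dvd_def by blast
  have "of_int (b * d) * (x + y) = of_int d * (of_int b * x) + of_int b * (of_int d * y)"
    by (simp add: algebra_simps)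
  also have "\<dots> = of_int (p ^ e * (d * a + b * c))"
    unfolding * by (simp add: algebra_simps)
  finally show ?thesis
    unfolding loc_dvd_def using * p by (metis prime_dvd_mult_iff)
qed

lemma loc_dvd_mult:
  assumes p: "prime p" and "loc_dvd p e x" "loc_dvd p f y"
  shows "loc_dvd p (e + f) (x * y)"
proof -
  obtain a b c d where *: "\<not> p dvd b" "of_int b * x = of_int (p ^ e * a)"
    "\<not> p dvd d" "of_int d * y = of_int (p ^ f * c)"
    using assms(2,3) unfolding loc_dvd_def by blast
  have "of_int (b * d) * (x * y) = (of_int b * x) * (of_int d * y)"
    by (simp add: algebra_simps)
  also have "\<dots> = of_int (p ^ (e + f) * (a * c))"
    unfolding * by (simp add: algebra_simps power_add)
  finally show ?thesis
    unfolding loc_dvd_def using * p by (metis prime_dvd_mult_iff)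
qed

lemma loc_dvd_mult_left:
  assumes "prime p" "loc_dvd p 0 x" "loc_dvd p e y"
  shows "loc_dvd p e (x * y)"
  using loc_dvd_mult[OF assms] by simp

lemma loc_dvd_mult_right:
  assumes "prime p" "loc_dvd p e x" "loc_dvd p 0 y"
  shows "loc_dvd p e (x * y)"
  using loc_dvd_mult[OF assms] by simp

lemma loc_dvd_sum:
  assumes "prime p" "\<And>i. i \<in> S \<Longrightarrow> loc_dvd p e (f i)"
  shows "loc_dvd p e (sum f S)"
  using assms(2) by (induction S rule: infinite_finite_induct) (auto intro: loc_dvd_add assms(1) loc_dvd_0)

lemma loc_dvd_mono:
  assumes "loc_dvd p e x" "f \<le> e"
  shows "loc_dvd p f x"
proof -
  obtain a b where "\<not> p dvd b" "of_int b * x = of_int (p ^ e * a)"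
    using assms unfolding loc_dvd_def by blast
  moreover have "p ^ e * a = p ^ f * (p ^ (e - f) * a)"
    using assms(2) by (simp flip: power_add mult.assoc)
  ultimately show ?thesis unfolding loc_dvd_def by metis
qed

lemma loc_dvd_cancel_unit:
  assumes "prime p" "\<not> p dvd c" "loc_dvd p e (of_int c * x)"
  shows "loc_dvd p e x"
proof -
  obtain a b where "\<not> p dvd b" "of_int b * (of_int c * x) = of_int (p ^ e * a)"
    using assms unfolding loc_dvd_def by blast
  moreover from this have "of_int (b * c) * x = of_int (p ^ e * a)" by simp
  ultimately show ?thesis
    unfolding loc_dvd_def using assms by (metis prime_dvd_mult_iff)
qed

lemma loc_dvd_cancel_power:
  assumes "prime p" "loc_dvd p (w + e) (of_int (p ^ w) * x)"
  shows "loc_dvd p e x"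
proof -
  obtain a b where b: "\<not> p dvd b" "of_int b * (of_int (p ^ w) * x) = of_int (p ^ (w + e) * a)"
    using assms unfolding loc_dvd_def by blast
  have "of_int (p ^ w) * (of_int b * x) = of_int (p ^ w) * of_int (p ^ e * a)"
    using b(2) by (simp add: power_add algebra_simps)
  then have "of_int b * x = of_int (p ^ e * a)"
    using assms(1) by (subst (asm) mult_cancel_left) auto
  then show ?thesis unfolding loc_dvd_def using b by blast
qed

text \<open>Cross-multiplying with the reduced fraction \<open>c / d\<close> gives
  \<open>b * c = p ^ e * a * d\<close>, and \<open>b\<close> is coprime to
  \<open>p ^ e\<close>.\<close>

lemma rat_cong_zero_if_loc_dvd:
  assumes p: "prime p" and "loc_dvd p e x"
  shows "rat_cong_zero x (p ^ e)"
proof -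
  obtain a b where b: "\<not> p dvd b" "of_int b * x = of_int (p ^ e * a)"
    using assms unfolding loc_dvd_def by blast
  obtain c d where cd: "quotient_of x = (c, d)" by force
  have d: "d > 0" using cd by (rule quotient_of_denom_pos)
  have x: "x = of_int c / of_int d" using cd by (rule quotient_of_div)
  have "(of_int (b * c) :: rat) = of_int b * x * of_int d"
    using d by (simp add: x)
  also have "\<dots> = of_int (p ^ e * a * d)" by (simp add: b(2))
  finally have "b * c = p ^ e * a * d" by (simp only: of_int_eq_iff)
  then have "p ^ e dvd b * c" by simp
  moreover have "coprime (p ^ e) b"
    using p b(1) by (simp add: prime_imp_coprime)
  ultimately have "p ^ e dvd c" by (simp add: coprime_dvd_mult_right_iff)
  then show ?thesis by (simp add: rat_cong_zero_def cd)
qed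

text \<open>Approximation by an ordinary binomial coefficient: if a natural number \<open>z\<close>
  is close enough to \<open>c\<close> in the p-adic sense, the numerator of
  \<open>c gchoose n\<close> inherits from \<open>z choose n\<close> all the factors
  \<open>p\<close> of \<open>fact n\<close>.\<close>

lemma loc_dvd_gchoose:
  assumes p: "prime p" and "loc_dvd p 0 c"
  shows "loc_dvd p 0 (c gchoose n)"
proof -
  obtain a b where b: "\<not> p dvd b" "of_int b * c = of_int a"
    using assms unfolding loc_dvd_def by auto
  define v where "v = multiplicity p (fact n :: int)"
  obtain f where f: "(fact n :: int) = p ^ v * f" "\<not> p dvd f"
    unfolding v_def
    by (rule multiplicity_decompose'[of "fact n :: int" p]) (use p in \<open>auto simp: not_prime_unit\<close>)
  have cop: "coprime b (p ^ v)"
    using prime_imp_coprime[OF p b(1)] by (simp add: coprime_commute)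
  obtain b' where b': "[b * b' = 1] (mod p ^ v)"
    using cong_solve_coprime_int[OF cop] by blast
  \<comment> \<open>\<open>b'\<close> inverts \<open>b\<close> modulo \<open>p ^ v\<close>, so
    \<open>z\<close> is a natural number representing \<open>a / b\<close> to the precision
    \<open>v\<close>, the valuation of \<open>fact n\<close>.\<close>
  define z where "z = nat ((a * b') mod p ^ v)"
  have pv: "p ^ v > 0" using p by (simp add: prime_gt_0_int)
  then have "int z = (a * b') mod p ^ v" by (simp add: z_def)
  then have "[int z = a * b'] (mod p ^ v)" by (simp add: cong_def)
  then have "[b * int z = a * (b * b')] (mod p ^ v)"
    by (metis cong_scalar_left mult.left_commute)
  also have "[a * (b * b') = a * 1] (mod p ^ v)" using b' by (rule cong_scalar_left)
  finally have bz: "[b * int z = a] (mod p ^ v)" by simp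
  \<comment> \<open>\<open>P\<close> equals \<open>b ^ n * fact n * (c gchoose n)\<close>, the
    binomial coefficient with all denominators cleared.\<close>
  define P where "P = (\<Prod>i<n. a - b * int i)"
  have "[P = (\<Prod>i<n. b * int z - b * int i)] (mod p ^ v)"
    unfolding P_def by (intro cong_prod cong_diff cong_refl cong_sym[OF bz])
  also have "(\<Prod>i<n. b * int z - b * int i) = b ^ n * (\<Prod>i<n. int z - int i)"
    by (simp add: prod.distrib flip: right_diff_distrib)
  also have "(\<Prod>i<n. int z - int i) = fact n * int (z choose n)"
  proof -
    have "(of_int (\<Prod>i<n. int z - int i) :: rat) = of_int (fact n * int (z choose n))"
      by (simp add: binomial_gbinomial gbinomial_mult_fact atLeast0LessThan)
    then show ?thesis by (simp only: of_int_eq_iff)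
  qed
  finally have "[P = p ^ v * (b ^ n * f * int (z choose n))] (mod p ^ v)"
    by (simp add: f ac_simps)
  then have "p ^ v dvd P" by (metis cong_dvd_iff dvd_triv_left)
  then obtain Q where Q: "P = p ^ v * Q" by blast
  have "of_int (b ^ n) * (of_int (fact n) * (c gchoose n)) = of_int (b ^ n) * (\<Prod>i<n. c - of_nat i)"
    by (simp add: gbinomial_mult_fact atLeast0LessThan)
  also have "\<dots> = (\<Prod>i<n. of_int b * (c - of_nat i))" by (simp add: prod.distrib)
  also have "\<dots> = of_int P" by (simp add: P_def right_diff_distrib b(2))
  finally have "of_int (p ^ v) * (of_int (b ^ n * f) * (c gchoose n)) = of_int (p ^ v) * of_int Q"
    by (simp add: f Q ac_simps)
  then have "of_int (b ^ n * f) * (c gchoose n) = of_int Q"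
    using pv p by (subst (asm) mult_cancel_left) auto
  moreover have "\<not> p dvd b ^ n * f"
    using b(1) f(2) p by (auto simp: prime_dvd_mult_iff dest: prime_dvd_power)
  ultimately show ?thesis
    unfolding loc_dvd_def by (intro exI[of _ Q] exI[of _ "b ^ n * f"]) simp
qed

section \<open>Coefficients of the Euler product\<close>

lemma neg_fps_X_power_power:
  "((- (fps_X ^ m)) :: 'a::comm_ring_1 fps) ^ k = fps_const ((- 1) ^ k) * fps_X ^ (m * k)"
  by (subst power_minus) (simp add: power_mult fps_const_power[symmetric] fps_const_neg[symmetric] del: fps_const_power fps_const_neg)

lemma euler_factor_nth:
  "fps_nth (euler_factor t i) n =
     (\<Sum>k = 0..n. (t gchoose k) * ((- 1) ^ k * (if n = Suc i * k then 1 else 0)))"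
  unfolding euler_factor_def fps_compose_nth neg_fps_X_power_power
  by (simp only: fps_mult_left_const_nth fps_X_power_nth fps_binomial_nth)

text \<open>The numbers \<open>of_nat n * fps_nth f n\<close> are the coefficients of
  \<open>X f'\<close>. The predicate thus says that \<open>f\<close> is p-integral and that
  \<open>X f'\<close> vanishes modulo \<open>p ^ e\<close>.\<close>

definition loc_deriv_dvd :: "int \<Rightarrow> nat \<Rightarrow> rat fps \<Rightarrow> bool" where
  "loc_deriv_dvd p e f \<longleftrightarrow> (\<forall>n. loc_dvd p 0 (fps_nth f n) \<and> loc_dvd p e (of_nat n * fps_nth f n))"

lemma loc_deriv_dvd_1: "prime p \<Longrightarrow> loc_deriv_dvd p e 1"
  unfolding loc_deriv_dvd_def using loc_dvd_of_int[of p 0 1] by auto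

text \<open>Leibniz rule: split the weight \<open>n\<close> as \<open>i + (n - i)\<close> in the
  convolution.\<close>

lemma loc_deriv_dvd_mult:
  assumes p: "prime p" and f: "loc_deriv_dvd p e f" and g: "loc_deriv_dvd p e g"
  shows "loc_deriv_dvd p e (f * g)"
  unfolding loc_deriv_dvd_def
proof (intro allI conjI)
  fix n
  show "loc_dvd p 0 (fps_nth (f * g) n)"
    unfolding fps_mult_nth using f g
    by (intro loc_dvd_sum loc_dvd_mult_left p) (auto simp: loc_deriv_dvd_def)
  have "of_nat n * fps_nth (f * g) n =
      (\<Sum>i = 0..n. of_nat i * fps_nth f i * fps_nth g (n - i) +
        fps_nth f i * (of_nat (n - i) * fps_nth g (n - i)))"
    unfolding fps_mult_nth sum_distrib_left
    by (intro sum.cong) (auto simp: algebra_simps of_nat_diff)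
  also have "loc_dvd p e \<dots>"
    using f g unfolding loc_deriv_dvd_def
    by (intro loc_dvd_sum loc_dvd_add loc_dvd_mult_left[of p "fps_nth f _"]
        loc_dvd_mult_right[of p e "of_nat _ * fps_nth f _"] p) blast+
  finally show "loc_dvd p e (of_nat n * fps_nth (f * g) n)" .
qed

lemma loc_deriv_dvd_prod:
  assumes "prime p" "\<And>i. i \<in> S \<Longrightarrow> loc_deriv_dvd p e (f i)"
  shows "loc_deriv_dvd p e (prod f S)"
  using assms(2)
  by (induction S rule: infinite_finite_induct)
    (auto intro: loc_deriv_dvd_1 loc_deriv_dvd_mult assms(1))

text \<open>The absorption identity \<open>k (t choose k) = t (t - 1 choose k - 1)\<close> extracts
  the factor \<open>t\<close>, and what remains is p-integral.\<close>

lemma loc_deriv_dvd_euler_factor: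
  assumes p: "prime p" and t: "loc_dvd p e t"
  shows "loc_deriv_dvd p e (euler_factor t i)"
  unfolding loc_deriv_dvd_def
proof (intro allI conjI)
  fix n
  have t0: "loc_dvd p 0 t" using t by (rule loc_dvd_mono) simp
  have sgn: "loc_dvd p 0 ((- 1) ^ k * (if b then 1 else 0))" for k b
    using loc_dvd_of_int[OF p, of 0 "(- 1) ^ k * (if b then 1 else 0)"] by (simp split: if_splits)
  show "loc_dvd p 0 (fps_nth (euler_factor t i) n)"
    unfolding euler_factor_nth by (intro loc_dvd_sum loc_dvd_mult_left loc_dvd_gchoose sgn p t0)
  have k: "loc_dvd p e (of_nat k * (t gchoose k))" for k
  proof (cases k)
    case (Suc l)
    have "of_nat (Suc l) * (t gchoose Suc l) = t * ((t - 1) gchoose l)"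
      by (rule gbinomial_absorption)
    moreover have "loc_dvd p 0 (t + of_int (- 1))"
      by (intro loc_dvd_add loc_dvd_of_int p t0) simp
    ultimately show ?thesis
      unfolding Suc by (auto intro!: loc_dvd_mult_right p t loc_dvd_gchoose)
  qed (use p in simp)
  \<comment> \<open>Only \<open>n = Suc i * k\<close> contributes, so the weight \<open>n\<close>
    may be replaced by \<open>k\<close> times the integer \<open>Suc i\<close>.\<close>
  have "of_nat n * fps_nth (euler_factor t i) n =
     (\<Sum>k = 0..n. of_nat k * (t gchoose k) * (of_int (int (Suc i)) * ((- 1) ^ k * (if n = Suc i * k then 1 else 0))))"
    unfolding euler_factor_nth sum_distrib_left by (intro sum.cong) (auto simp: algebra_simps)
  also have "loc_dvd p e \<dots>"
    by (intro loc_dvd_sum loc_dvd_mult_right loc_dvd_mult_left[of p "of_int _"] loc_dvd_of_int k sgn p) simp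
  finally show "loc_dvd p e (of_nat n * fps_nth (euler_factor t i) n)" .
qed

section \<open>The finite q-binomial theorem and theta series\<close>

text \<open>The q-Pochhammer symbol \<open>(q; q)_n\<close>.\<close>

definition q_poch :: "'a::comm_ring_1 \<Rightarrow> nat \<Rightarrow> 'a" where
  "q_poch q n = (\<Prod>i<n. 1 - q ^ Suc i)"

text \<open>Gaussian binomial coefficients through a q-Pascal recurrence, hence without division and
  over any commutative ring.\<close>

fun q_binomial :: "'a::comm_ring_1 \<Rightarrow> nat \<Rightarrow> nat \<Rightarrow> 'a" where
  "q_binomial q n 0 = 1"
| "q_binomial q 0 (Suc k) = 0"
| "q_binomial q (Suc n) (Suc k) = q_binomial q n (Suc k) + q ^ (n - k) * q_binomial q n k"

lemma q_poch_0 [simp]: "q_poch q 0 = 1"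
  by (simp add: q_poch_def)

lemma q_poch_Suc: "q_poch q (Suc n) = q_poch q n * (1 - q ^ Suc n)"
  by (simp add: q_poch_def)

lemma q_binomial_eq_0: "n < k \<Longrightarrow> q_binomial q n k = 0"
  by (induction q n k rule: q_binomial.induct) auto

lemma q_binomial_self: "q_binomial q n n = 1"
  by (induction n) (auto simp: q_binomial_eq_0)

text \<open>The product formula for Gaussian binomials with denominators cleared. The two Pascal
  terms combine because \<open>(1 - q ^ Suc d) + q ^ Suc d * (1 - q ^ Suc k) = 1 - q ^ Suc n\<close>
  for \<open>d = n - k - 1\<close>.\<close>

lemma q_binomial_mult_poch:
  "k \<le> n \<Longrightarrow> q_binomial q n k * q_poch q k * q_poch q (n - k) = q_poch q n"
proof (induction q n k rule: q_binomial.induct)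
  case (3 q n k)
  show ?case
  proof (cases "k = n")
    case True
    then show ?thesis by (simp add: q_binomial_eq_0 q_binomial_self)
  next
    case False
    with 3 have k: "k < n" by simp
    then obtain d where d: "n = Suc (k + d)" by (metis less_imp_Suc_add)
    have IH: "q_binomial q n (Suc k) * q_poch q (Suc k) * q_poch q d = q_poch q n"
      "q_binomial q n k * q_poch q k * q_poch q (Suc d) = q_poch q n"
      using 3 k d by simp_all
    have "q_binomial q (Suc n) (Suc k) * q_poch q (Suc k) * q_poch q (Suc n - Suc k) =
       q_binomial q n (Suc k) * q_poch q (Suc k) * q_poch q d * (1 - q ^ Suc d) +
       q ^ Suc d * (1 - q ^ Suc k) * (q_binomial q n k * q_poch q k * q_poch q (Suc d))"
      by (simp add: d q_poch_Suc algebra_simps)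
    also have "\<dots> = q_poch q n * (1 - q ^ Suc n)"
      unfolding IH by (simp add: d algebra_simps power_add)
    finally show ?thesis by (simp only: q_poch_Suc)
  qed
qed simp_all

text \<open>Multiplying by the next linear factor acts on the coefficients by \<open>c_Suc\<close>,
  which is the q-Pascal recurrence with signs and powers of \<open>q\<close> attached. The identity
  is one of polynomials so that it can be differentiated and evaluated at powers of
  \<open>q\<close>.\<close>

lemma q_binomial_theorem:
  fixes q :: "'a::comm_ring_1"
  shows "(\<Prod>j<n. [:- (q ^ j), 1:]) =
    (\<Sum>k\<le>n. monom ((- 1) ^ k * q ^ (k choose 2) * q_binomial q n k) (n - k))"
proof (induction n)
  case (Suc n)
  define c where "c n k = (- 1) ^ k * q ^ (k choose 2) * q_binomial q n k" for n k
  have c_Suc: "c (Suc n) (Suc k) = c n (Suc k) - q ^ n * c n k" if "k \<le> n" for k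
  proof -
    have "q ^ n = q ^ k * q ^ (n - k)" using that by (simp flip: power_add)
    then show ?thesis
      by (simp add: c_def numeral_2_eq_2 power_add algebra_simps)
  qed
  have "(\<Sum>k\<le>Suc n. monom (c (Suc n) k) (Suc n - k)) =
      monom (c n 0) (Suc n) + (\<Sum>k\<le>n. monom (c n (Suc k) - q ^ n * c n k) (n - k))"
    by (simp add: sum.atMost_Suc_shift c_Suc del: sum.atMost_Suc) (simp add: c_def)
  also have "\<dots> = monom (c n 0) (Suc n) + (\<Sum>k\<le>n. monom (c n (Suc k)) (n - k))
      - [:q ^ n:] * (\<Sum>k\<le>n. monom (c n k) (n - k))"
    by (simp add: diff_monom[symmetric] sum_subtractf sum_distrib_left smult_monom del: mult_pCons_left)
      (simp add: smult_monom)
  also have "monom (c n 0) (Suc n) + (\<Sum>k\<le>n. monom (c n (Suc k)) (n - k)) =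
      (\<Sum>k\<le>Suc n. monom (c n k) (Suc n - k))"
    by (simp add: sum.atMost_Suc_shift del: sum.atMost_Suc)
  also have "\<dots> = (\<Sum>k\<le>n. monom (c n k) (Suc n - k))"
    by (simp add: c_def q_binomial_eq_0)
  also have "\<dots> = [:0, 1:] * (\<Sum>k\<le>n. monom (c n k) (n - k))"
    unfolding sum_distrib_left by (intro sum.cong) (auto simp: Suc_diff_le monom_Suc)
  finally have "(\<Sum>k\<le>Suc n. monom (c (Suc n) k) (Suc n - k)) =
      (\<Sum>k\<le>n. monom (c n k) (n - k)) * [:- (q ^ n), 1:]"
    by (simp add: algebra_simps)
  then show ?case
    using Suc.IH unfolding c_def by simp
qed (simp add: one_pCons monom_0 numeral_2_eq_2)

lemma two_mult_choose_two: "2 * int (n choose 2) = int n * (int n - 1)"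
proof -
  have "even (n * (n - 1))" by (cases n) simp_all
  then have "2 * (n choose 2) = n * (n - 1)" by (simp add: choose_two)
  then have "2 * int (n choose 2) = int (n * (n - 1))" by linarith
  then show ?thesis by (cases n) (simp_all add: algebra_simps)
qed

text \<open>Placed in the locale so that it serves both \<open>sum\<close> and
  \<open>prod\<close>.\<close>

lemma (in comm_monoid_set) lessThan_add:
  fixes m n :: nat
  shows "F g {..<m + n} = F g {..<m} \<^bold>* F (\<lambda>j. g (m + j)) {..<n}"
  by (induction n) (simp_all add: assoc)

lemma prod_power_lessThan:
  fixes q :: "'a::comm_monoid_mult"
  shows "(\<Prod>j<n. q ^ j) = q ^ (n choose 2)"
  by (induction n) (simp_all add: numeral_2_eq_2 power_add ac_simps)

lemma prod_power_diff:
  fixes q :: "'a::comm_ring_1"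
  shows "(\<Prod>j<n. q ^ n - q ^ j) = (- 1) ^ n * q ^ (n choose 2) * q_poch q n"
proof -
  have "(\<Prod>j<n. q ^ n - q ^ j) = (\<Prod>j<n. (- 1) * q ^ j * (1 - q ^ Suc (n - Suc j)))"
    by (intro prod.cong) (auto simp: algebra_simps simp flip: power_add power_Suc)
  also have "\<dots> = (- 1) ^ n * (\<Prod>j<n. q ^ j) * (\<Prod>j<n. 1 - q ^ Suc (n - Suc j))"
    by (simp only: prod.distrib prod_constant card_lessThan)
  also have "(\<Prod>j<n. 1 - q ^ Suc (n - Suc j)) = q_poch q n"
    unfolding q_poch_def by (rule prod.nat_diff_reindex)
  also have "(\<Prod>j<n. q ^ j) = q ^ (n choose 2)"
    by (rule prod_power_lessThan)
  finally show ?thesis .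
qed

text \<open>The product formula is symmetric in \<open>k\<close> and \<open>n - k\<close>; since
  \<open>q\<close> is not a root of unity, the Pochhammer factors are nonzero and cancel.\<close>

lemma q_binomial_symmetric:
  fixes q :: "'a::idom"
  assumes "\<And>m. m > 0 \<Longrightarrow> q ^ m \<noteq> 1" and "k \<le> n"
  shows "q_binomial q n (n - k) = q_binomial q n k"
proof -
  have nz: "q_poch q m \<noteq> 0" for m
    using assms(1)[of "Suc _"] by (simp add: q_poch_def)
  have "q_binomial q n (n - k) * (q_poch q k * q_poch q (n - k)) =
      q_binomial q n k * (q_poch q k * q_poch q (n - k))"
    using q_binomial_mult_poch[of k n q] q_binomial_mult_poch[of "n - k" n q] assms(2)
    by (simp add: ac_simps)
  then show ?thesis using nz by simp
qed

text \<open>Differentiate the $q$-binomial theorem for \<open>2 n + 1\<close> factors at the root \<open>q ^ n\<close>;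
  the terms \<open>k = n - i\<close> and \<open>k = n + 1 + i\<close> combine.\<close>

lemma finite_jacobi:
  fixes q :: "'a::idom"
  assumes q: "\<And>m. m > 0 \<Longrightarrow> q ^ m \<noteq> 1" "q \<noteq> 0"
  shows "q_poch q n ^ 2 = (\<Sum>i\<le>n. (- 1) ^ i * of_nat (2 * i + 1) * q ^ (Suc i choose 2) *
    q_binomial q (2 * n + 1) (n - i))"
proof -
  define N where "N = 2 * n + 1"
  define P where "P = (\<Prod>j<N. [:- (q ^ j), 1:])"
  define R where "R = (\<Prod>j<n. [:- (q ^ j), 1:]) * (\<Prod>j<n. [:- (q ^ (Suc n + j)), 1:])"
  define a where "a = (n choose 2) + n * n + n"
  have N: "N = Suc n + n" by (simp add: N_def)
  have "P = (\<Prod>j<Suc n. [:- (q ^ j), 1:]) * (\<Prod>j<n. [:- (q ^ (Suc n + j)), 1:])"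
    unfolding P_def N by (rule prod.lessThan_add)
  then have "P = [:- (q ^ n), 1:] * R"
    unfolding R_def by (simp only: prod.lessThan_Suc mult_ac)
  \<comment> \<open>At the root \<open>q ^ n\<close> only the product-rule term that differentiates
    the vanishing linear factor survives.\<close>
  then have "poly (pderiv P) (q ^ n) = poly R (q ^ n)"
    by (simp add: pderiv_mult pderiv_pCons del: mult_pCons_left)
  also have "\<dots> = (\<Prod>j<n. q ^ n - q ^ j) * (\<Prod>j<n. q ^ n - q ^ (Suc n + j))"
    by (simp add: R_def poly_prod)
  also have "(\<Prod>j<n. q ^ n - q ^ (Suc n + j)) = (\<Prod>j<n. q ^ n * (1 - q ^ Suc j))"
    by (simp add: algebra_simps power_add)
  also have "\<dots> = q ^ (n * n) * q_poch q n"
    by (simp only: prod.distrib prod_constant card_lessThan q_poch_def power_mult)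
  \<comment> \<open>The extra factor \<open>q ^ n\<close> makes up for the degree lost in
    differentiation, so that \<open>rhs\<close> carries the exponent
    \<open>n * (N - k)\<close>.\<close>
  finally have lhs: "q ^ n * poly (pderiv P) (q ^ n) = (- 1) ^ n * q ^ a * q_poch q n ^ 2"
    by (simp add: prod_power_diff a_def power_add power2_eq_square ac_simps)
  have rhs: "q ^ n * poly (pderiv P) (q ^ n) =
      (\<Sum>k\<le>N. (- 1) ^ k * q ^ (k choose 2) * q_binomial q N k * of_nat (N - k) * q ^ (n * (N - k)))"
  proof -
    have *: "q ^ n * poly (pderiv (monom c m)) (q ^ n) = c * of_nat m * q ^ (n * m)" for c m
      unfolding power_mult by (cases m) (simp_all add: pderiv_monom poly_monom ac_simps)
    show ?thesis
      unfolding P_def q_binomial_theorem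
      by (simp only: higher_pderiv_sum[of 1, simplified] poly_sum sum_distrib_left *)
  qed
  define t where "t k = (- 1) ^ k * q ^ (k choose 2) * q_binomial q N k * of_nat (N - k) * q ^ (n * (N - k))" for k
  have "(\<Sum>k\<le>N. t k) = (\<Sum>i\<le>n. t (n - i)) + (\<Sum>i\<le>n. t (Suc n + i))"
  proof -
    have "{..N} = {..<Suc n + Suc n}" by (auto simp: N_def)
    then have "(\<Sum>k\<le>N. t k) = (\<Sum>i\<le>n. t i) + (\<Sum>i\<le>n. t (Suc n + i))"
      by (simp only: sum.lessThan_add lessThan_Suc_atMost)
    also have "(\<Sum>i\<le>n. t i) = (\<Sum>i\<le>n. t (n - i))"
      using sum.nat_diff_reindex[of t "Suc n"] by (simp add: lessThan_Suc_atMost)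
    finally show ?thesis .
  qed
  also have "\<dots> = (\<Sum>i\<le>n. (- 1) ^ n * q ^ a * ((- 1) ^ i * of_nat (2 * i + 1) * q ^ (Suc i choose 2) *
    q_binomial q N (n - i)))"
    unfolding sum.distrib[symmetric]
  proof (intro sum.cong refl)
    fix i assume "i \<in> {..n}"
    then obtain d where d: "n = i + d" by (auto simp: le_iff_add)
    \<comment> \<open>Both paired terms carry the same power of \<open>q\<close>. The exponents are
      compared after doubling, in the integers, to avoid halves and truncated subtraction.\<close>
    have e1: "((n - i) choose 2) + n * (N - (n - i)) = a + (Suc i choose 2)"
    proof -
      have "2 * int (((n - i) choose 2) + n * (N - (n - i))) = 2 * int (a + (Suc i choose 2))"
        unfolding a_def of_nat_add distrib_left two_mult_choose_two
        by (simp add: d N_def algebra_simps)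
      then show ?thesis by (metis mult_cancel_left of_nat_eq_iff zero_neq_numeral)
    qed
    have e2: "((Suc n + i) choose 2) + n * (N - (Suc n + i)) = a + (Suc i choose 2)"
    proof -
      have "2 * int (((Suc n + i) choose 2) + n * (N - (Suc n + i))) = 2 * int (a + (Suc i choose 2))"
        unfolding a_def of_nat_add distrib_left two_mult_choose_two
        by (simp add: d N_def algebra_simps)
      then show ?thesis by (metis mult_cancel_left of_nat_eq_iff zero_neq_numeral)
    qed
    have s: "(- 1 :: 'a) ^ (n - i) = (- 1) ^ n * (- 1) ^ i"
      by (simp add: d power_add flip: power_mult_distrib mult.assoc)
    have sym: "q_binomial q N (Suc n + i) = q_binomial q N (n - i)"
    proof -
      have "n - i \<le> N" "N - (n - i) = Suc n + i" by (simp_all add: N_def d)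
      then show ?thesis using q_binomial_symmetric[OF q(1), of "n - i" N] by metis
    qed
    have "t (n - i) = (- 1) ^ (n - i) * q ^ (((n - i) choose 2) + n * (N - (n - i))) *
        q_binomial q N (n - i) * of_nat (N - (n - i))"
      by (simp add: t_def power_add ac_simps)
    then have t1: "t (n - i) = (- 1) ^ n * (- 1) ^ i * q ^ (a + (Suc i choose 2)) *
        q_binomial q N (n - i) * of_nat (n + 1 + i)"
      unfolding e1 s by (simp add: N_def d)
    have "t (Suc n + i) = (- 1) ^ (Suc n + i) * q ^ (((Suc n + i) choose 2) + n * (N - (Suc n + i))) *
        q_binomial q N (Suc n + i) * of_nat (N - (Suc n + i))"
      by (simp add: t_def power_add ac_simps)
    then have t2: "t (Suc n + i) = - ((- 1) ^ n * (- 1) ^ i * q ^ (a + (Suc i choose 2)) *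
        q_binomial q N (n - i) * of_nat (n - i))"
      unfolding e2 sym by (simp add: N_def d power_add)
    \<comment> \<open>The derivative weights \<open>n + 1 + i\<close> and \<open>n - i\<close> enter
      with opposite signs and leave \<open>2 * i + 1\<close>.\<close>
    show "t (n - i) + t (Suc n + i) = (- 1) ^ n * q ^ a * ((- 1) ^ i * of_nat (2 * i + 1) * q ^ (Suc i choose 2) *
        q_binomial q N (n - i))"
      unfolding t1 t2 by (simp add: d power_add algebra_simps del: binomial_Suc_Suc)
  qed
  also have "\<dots> = (- 1) ^ n * q ^ a * (\<Sum>i\<le>n. (- 1) ^ i * of_nat (2 * i + 1) * q ^ (Suc i choose 2) *
    q_binomial q N (n - i))"
    by (simp only: sum_distrib_left)
  finally have "(- 1) ^ n * q ^ a * q_poch q n ^ 2 = (- 1) ^ n * q ^ a * (\<Sum>i\<le>n. (- 1) ^ i * of_nat (2 * i + 1) * q ^ (Suc i choose 2) *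
    q_binomial q N (n - i))"
    unfolding t_def using lhs rhs by (simp only:)
  then show ?thesis
    using q(2) unfolding N_def by (subst (asm) mult_cancel_left) auto
qed

text \<open>Evaluate the q-binomial theorem with base \<open>q ^ 3\<close> and
  \<open>2 * Suc n\<close> factors at \<open>q ^ (3 * n + 2)\<close>. The two halves of the product
  yield the factors with exponents 2 and 1 modulo 3; multiplying by
  \<open>q_poch (q ^ 3) (Suc n)\<close> supplies the multiples of 3.\<close>

lemma finite_pentagonal:
  fixes q :: "'a::comm_ring_1"
  shows "(- 1) ^ Suc n * q ^ (3 * (Suc n choose 2) + (3 * n + 2) * Suc n) * q_poch q (3 * Suc n) =
    (\<Sum>k\<le>2 * Suc n. (- 1) ^ k * q ^ (3 * (k choose 2) + (3 * n + 2) * (2 * Suc n - k)) *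
      (q_poch (q ^ 3) (Suc n) * q_binomial (q ^ 3) (2 * Suc n) k))"
proof -
  define N where "N = 2 * Suc n"
  define P where "P = (\<Prod>j<N. [:- ((q ^ 3) ^ j), 1:])"
  have "poly P (q ^ (3 * n + 2)) = (\<Prod>j<N. q ^ (3 * n + 2) - q ^ (3 * j))"
    by (simp add: P_def poly_prod power_mult)
  also have "\<dots> = (\<Prod>j<Suc n. q ^ (3 * n + 2) - q ^ (3 * j)) *
      (\<Prod>j<Suc n. q ^ (3 * n + 2) - q ^ (3 * (Suc n + j)))"
    unfolding N_def mult_2 by (rule prod.lessThan_add)
  also have "(\<Prod>j<Suc n. q ^ (3 * n + 2) - q ^ (3 * (Suc n + j))) =
      (\<Prod>j<Suc n. q ^ (3 * n + 2) * (1 - q ^ (3 * j + 1)))"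
  proof -
    have "3 * (Suc n + j) = (3 * n + 2) + (3 * j + 1)" for j by simp
    then show ?thesis by (simp only: power_add right_diff_distrib mult_1_right)
  qed
  also have "\<dots> = q ^ ((3 * n + 2) * Suc n) * (\<Prod>j<Suc n. 1 - q ^ (3 * j + 1))"
    by (simp only: prod.distrib prod_constant card_lessThan power_mult)
  also have "(\<Prod>j<Suc n. q ^ (3 * n + 2) - q ^ (3 * j)) =
      (\<Prod>j<Suc n. (- 1) * (q ^ 3) ^ j * (1 - q ^ (3 * (Suc n - Suc j) + 2)))"
    by (intro prod.cong)
      (auto simp: algebra_simps less_Suc_eq_le diff_mult_distrib2 simp flip: power_add power_Suc power_mult)
  also have "\<dots> = (- 1) ^ Suc n * (\<Prod>j<Suc n. (q ^ 3) ^ j) * (\<Prod>j<Suc n. 1 - q ^ (3 * (Suc n - Suc j) + 2))"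
    by (simp only: prod.distrib prod_constant card_lessThan)
  also have "(\<Prod>j<Suc n. 1 - q ^ (3 * (Suc n - Suc j) + 2)) = (\<Prod>j<Suc n. 1 - q ^ (3 * j + 2))"
    by (rule prod.nat_diff_reindex)
  also have "(\<Prod>j<Suc n. (q ^ 3) ^ j) = (q ^ 3) ^ (Suc n choose 2)"
    by (rule prod_power_lessThan)
  finally have "poly P (q ^ (3 * n + 2)) * q_poch (q ^ 3) (Suc n) =
      (- 1) ^ Suc n * q ^ (3 * (Suc n choose 2) + (3 * n + 2) * Suc n) *
      ((\<Prod>j<Suc n. 1 - q ^ (3 * j + 1)) * (\<Prod>j<Suc n. 1 - q ^ (3 * j + 2)) * q_poch (q ^ 3) (Suc n))"
    by (simp only: power_add power_mult ac_simps)
  also have "(\<Prod>j<m. 1 - q ^ (3 * j + 1)) * (\<Prod>j<m. 1 - q ^ (3 * j + 2)) * q_poch (q ^ 3) m =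
      q_poch q (3 * m)" for m
  proof (induction m)
    case (Suc m)
    have e: "3 * Suc m = Suc (Suc (Suc (3 * m)))" by simp
    have "q_poch q (3 * Suc m) =
        q_poch q (3 * m) * (1 - q ^ (3 * m + 1)) * (1 - q ^ (3 * m + 2)) * (1 - (q ^ 3) ^ Suc m)"
      unfolding power_mult[symmetric] unfolding e q_poch_Suc by (simp only: add_2_eq_Suc' Suc_eq_plus1)
    then show ?case
      unfolding Suc.IH[symmetric] by (simp only: q_poch_Suc prod.lessThan_Suc mult_ac)
  qed simp
  finally have "(- 1) ^ Suc n * q ^ (3 * (Suc n choose 2) + (3 * n + 2) * Suc n) * q_poch q (3 * Suc n) =
      poly P (q ^ (3 * n + 2)) * q_poch (q ^ 3) (Suc n)" ..
  also have "\<dots> = (\<Sum>k\<le>N. (- 1) ^ k * q ^ (3 * (k choose 2) + (3 * n + 2) * (N - k)) *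
      (q_poch (q ^ 3) (Suc n) * q_binomial (q ^ 3) N k))"
  proof -
    have e: "q ^ (3 * i + (3 * n + 2) * j) = (q ^ 3) ^ i * (q ^ (3 * n + 2)) ^ j" for i j
      by (simp only: power_add power_mult)
    show ?thesis
      unfolding P_def q_binomial_theorem poly_sum sum_distrib_right poly_monom
      unfolding e by (simp only: mult_ac)
  qed
  finally show ?thesis unfolding N_def .
qed

section \<open>Power series congruent to 1 modulo a power of \<open>fps_X\<close>\<close>

lemma fps_X_power_dvd_mult_diff_one:
  fixes f g :: "'a::comm_ring_1 fps"
  assumes "fps_X ^ d dvd f - 1" "fps_X ^ d dvd g - 1"
  shows "fps_X ^ d dvd f * g - 1"
proof -
  have "f * g - 1 = (f - 1) * g + (g - 1)" by (simp add: algebra_simps)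
  then show ?thesis using assms by (metis dvd_add dvd_mult2)
qed

lemma fps_X_power_dvd_prod_diff_one:
  fixes f :: "'b \<Rightarrow> 'a::comm_ring_1 fps"
  assumes "\<And>i. i \<in> S \<Longrightarrow> fps_X ^ d dvd f i - 1"
  shows "fps_X ^ d dvd prod f S - 1"
  using assms
  by (induction S rule: infinite_finite_induct) (auto intro: fps_X_power_dvd_mult_diff_one)

lemma fps_nth_if_X_power_dvd_diff_one:
  fixes f :: "'a::comm_ring_1 fps"
  assumes "fps_X ^ d dvd f - 1" "m < d"
  shows "fps_nth f m = (if m = 0 then 1 else 0)"
proof -
  obtain h where "f - 1 = fps_X ^ d * h" using assms(1) by blast
  then have "f = 1 + fps_X ^ d * h" by (simp add: algebra_simps)
  then show ?thesis using assms(2) by (simp add: fps_X_power_mult_nth)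
qed

context
  fixes c :: nat and q :: "'a::idom fps"
  assumes c: "c > 0"
  defines "q \<equiv> fps_X ^ c"
begin

lemma fps_X_power_power_neq_1: "m > 0 \<Longrightarrow> q ^ m \<noteq> 1"
proof
  assume "m > 0" "q ^ m = 1"
  then have "(fps_X ^ (c * m) :: 'a fps) = 1" by (simp only: q_def power_mult)
  then have "fps_nth (fps_X ^ (c * m) :: 'a fps) 0 = fps_nth 1 0" by (simp only:)
  then show False using c \<open>m > 0\<close> by (simp add: fps_X_power_nth)
qed

lemma q_poch_split:
  assumes "k \<le> n"
  obtains R where "q_poch q n = q_poch q k * R" "fps_X ^ (c * Suc k) dvd R - 1"
proof
  show "q_poch q n = q_poch q k * (\<Prod>i=k..<n. 1 - q ^ Suc i)"
    unfolding q_poch_def using prod.atLeastLessThan_concat[of 0 k n "\<lambda>i. 1 - q ^ Suc i"] assms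
    by (simp add: atLeast0LessThan del: power_Suc)
  show "fps_X ^ (c * Suc k) dvd (\<Prod>i=k..<n. 1 - q ^ Suc i) - 1"
  proof (rule fps_X_power_dvd_prod_diff_one)
    fix i assume "i \<in> {k..<n}"
    then have "c * Suc k \<le> c * Suc i" by simp
    then have "(fps_X ^ (c * Suc k) :: 'a fps) dvd fps_X ^ (c * Suc i)"
      by (rule le_imp_power_dvd)
    then show "fps_X ^ (c * Suc k) dvd 1 - q ^ Suc i - 1"
      by (simp add: q_def flip: power_mult del: mult_Suc_right power_Suc)
  qed
qed

text \<open>By the product formula the product is \<open>R * S\<close>, two tails of Pochhammer
  products, each congruent to 1 to the stated order. This replaces the passage to the limit in the
  finite theta identities: \<open>c = 1\<close> serves Jacobi and \<open>c = 3\<close> the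
  pentagonal numbers.\<close>

lemma q_poch_mult_q_binomial:
  assumes k: "k \<le> n" and m: "k \<le> m \<or> n - k \<le> m"
  shows "fps_X ^ (c * Suc (min k (n - k))) dvd q_poch q m * q_binomial q n k - 1"
proof -
  have *: "fps_X ^ (c * Suc (min k (n - k))) dvd q_poch q m * q_binomial q n k - 1"
    if k: "k \<le> n" and m: "k \<le> m" for k
  proof -
    let ?d = "c * Suc (min k (n - k))"
    obtain R where R: "q_poch q m = q_poch q k * R" "fps_X ^ (c * Suc k) dvd R - 1"
      using q_poch_split[OF m] by blast
    obtain S where S: "q_poch q n = q_poch q (n - k) * S" "fps_X ^ (c * Suc (n - k)) dvd S - 1"
      using q_poch_split[of "n - k" n] by auto
    have nz: "q_poch q m \<noteq> 0" for m
      using fps_X_power_power_neq_1[of "Suc _"] by (simp add: q_poch_def)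
    have "q_poch q k * q_poch q (n - k) * (q_poch q m * q_binomial q n k) =
        q_poch q m * (q_binomial q n k * q_poch q k * q_poch q (n - k))"
      by (simp add: ac_simps)
    also have "\<dots> = q_poch q k * q_poch q (n - k) * (R * S)"
      unfolding q_binomial_mult_poch[OF k] R(1) S(1) by (simp add: ac_simps)
    finally have eq: "q_poch q m * q_binomial q n k = R * S" using nz by simp
    have "(fps_X ^ ?d :: 'a fps) dvd fps_X ^ (c * Suc k)" "(fps_X ^ ?d :: 'a fps) dvd fps_X ^ (c * Suc (n - k))"
      by (auto intro!: le_imp_power_dvd)
    then show ?thesis
      unfolding eq using R(2) S(2) by (blast intro: fps_X_power_dvd_mult_diff_one dvd_trans)
  qed
  show ?thesis
  proof (cases "k \<le> m")
    case False
    then show ?thesis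
      using *[of "n - k"] k m q_binomial_symmetric[OF fps_X_power_power_neq_1, of k n]
      by (simp add: min.commute)
  qed (use * k in blast)
qed

end

section \<open>Coefficients of the two theta series\<close>

text \<open>One more factor \<open>q_poch fps_X n\<close> turns each term of the finite identity
  into a signed odd multiple of a triangular power of \<open>fps_X\<close> times a series that is 1
  up to the order in question.\<close>

lemma jacobi_nth:
  assumes "m \<le> n"
  shows "fps_nth (q_poch (fps_X :: 'a::idom fps) n ^ 3) m =
    (\<Sum>i\<le>n. if m = Suc i choose 2 then (- 1) ^ i * of_nat (2 * i + 1) else 0)"
proof -
  have const: "fps_const ((- 1) ^ i * of_nat j :: 'a) = (- 1) ^ i * of_nat j" for i j
    by (metis fps_const_mult fps_const_power fps_const_neg fps_of_nat fps_const_1_eq_1)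
  have sq: "q_poch (fps_X :: 'a fps) n ^ 2 = (\<Sum>i\<le>n. (- 1) ^ i * of_nat (2 * i + 1) *
      fps_X ^ (Suc i choose 2) * q_binomial fps_X (2 * n + 1) (n - i))"
    using fps_X_power_power_neq_1[of 1, where 'a = 'a]
    by (intro finite_jacobi) (simp_all only: power_one_right zero_less_one fps_X_neq_zero not_False_eq_True)
  have cube: "q_poch fps_X n ^ 3 = (\<Sum>i\<le>n. fps_const ((- 1) ^ i * of_nat (2 * i + 1)) *
      (fps_X ^ (Suc i choose 2) * (q_poch (fps_X :: 'a fps) n * q_binomial fps_X (2 * n + 1) (n - i))))"
    unfolding power3_eq_cube mult.assoc power2_eq_square[symmetric] sq sum_distrib_left
    by (simp only: const sum_distrib_left mult_ac)
  show ?thesis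
    unfolding cube fps_sum_nth fps_mult_left_const_nth fps_X_power_mult_nth
  proof (intro sum.cong refl)
    fix i assume i: "i \<in> {..n}"
    let ?f = "q_poch (fps_X :: 'a fps) n * q_binomial fps_X (2 * n + 1) (n - i)"
    \<comment> \<open>The triangular number is at least \<open>i\<close>, so the coefficient looked
      up has index at most \<open>n - i\<close>, just below the precision
      \<open>Suc (n - i)\<close>.\<close>
    have T: "i \<le> Suc i choose 2" by (simp add: numeral_2_eq_2)
    have "n - i \<le> 2 * n + 1 - (n - i)" by linarith
    then have "min (n - i) (2 * n + 1 - (n - i)) = n - i" by (rule min_absorb1)
    then have "fps_X ^ (Suc (n - i)) dvd ?f - 1"
      using q_poch_mult_q_binomial[of 1 "n - i" "2 * n + 1" n, where 'a = 'a] by simp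
    then have f: "fps_nth ?f (m - (Suc i choose 2)) = (if m - (Suc i choose 2) = 0 then 1 else 0)"
      by (rule fps_nth_if_X_power_dvd_diff_one)
        (rule le_imp_less_Suc[OF le_trans[OF diff_le_mono[OF assms] diff_le_mono2[OF T]]])
    show "(- 1) ^ i * of_nat (2 * i + 1) *
        (if m < Suc i choose 2 then 0 else fps_nth ?f (m - (Suc i choose 2))) =
        (if m = Suc i choose 2 then (- 1) ^ i * of_nat (2 * i + 1) else 0)"
      unfolding f by auto
  qed
qed

text \<open>A nonzero coefficient must come from some term \<open>k\<close> of the finite identity.
  That term is a power of \<open>fps_X\<close> times a series that is 1 to sufficient order, which
  forces \<open>m = i (3 i + 1) / 2\<close> and hence \<open>24 m + 1 = (6 i + 1)^2\<close>.\<close>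

lemma pentagonal_support:
  assumes nz: "fps_nth (q_poch (fps_X :: 'a::idom fps) (3 * Suc n)) m \<noteq> 0" and m: "m < 3 * Suc n"
  obtains x :: int where "24 * int m + 1 = x ^ 2"
proof -
  define a where "a = 3 * (Suc n choose 2) + (3 * n + 2) * Suc n"
  define b where "b k = 3 * (k choose 2) + (3 * n + 2) * (2 * Suc n - k)" for k
  define f where "f k = q_poch (fps_X ^ 3 :: 'a fps) (Suc n) * q_binomial (fps_X ^ 3) (2 * Suc n) k" for k
  have "(- 1) ^ Suc n * fps_X ^ a * q_poch (fps_X :: 'a fps) (3 * Suc n) =
      (\<Sum>k\<le>2 * Suc n. (- 1) ^ k * fps_X ^ b k * f k)"
    unfolding a_def b_def f_def by (rule finite_pentagonal)
  then have "fps_const ((- 1) ^ Suc n) * (fps_X ^ a * q_poch (fps_X :: 'a fps) (3 * Suc n)) =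
      (\<Sum>k\<le>2 * Suc n. fps_const ((- 1) ^ k) * (fps_X ^ b k * f k))"
    by (simp add: fps_const_power[symmetric] fps_const_neg[symmetric] ac_simps del: fps_const_power fps_const_neg)
  then have "fps_nth (fps_const ((- 1) ^ Suc n) * (fps_X ^ a * q_poch (fps_X :: 'a fps) (3 * Suc n))) (a + m) =
      fps_nth (\<Sum>k\<le>2 * Suc n. fps_const ((- 1) ^ k) * (fps_X ^ b k * f k)) (a + m)"
    by simp
  then have "(- 1) ^ Suc n * fps_nth (fps_X ^ a * q_poch (fps_X :: 'a fps) (3 * Suc n)) (a + m) =
      (\<Sum>k\<le>2 * Suc n. (- 1) ^ k * fps_nth (fps_X ^ b k * f k) (a + m))"
    by (simp only: fps_sum_nth fps_mult_left_const_nth)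
  moreover have "(- 1) ^ Suc n * fps_nth (fps_X ^ a * q_poch (fps_X :: 'a fps) (3 * Suc n)) (a + m) \<noteq> 0"
    using nz by (simp add: fps_X_power_mult_nth)
  ultimately have "(\<Sum>k\<le>2 * Suc n. (- 1) ^ k * fps_nth (fps_X ^ b k * f k) (a + m)) \<noteq> 0"
    by (simp only: not_False_eq_True)
  then obtain k where k: "k \<le> 2 * Suc n" "(- 1) ^ k * fps_nth (fps_X ^ b k * f k) (a + m) \<noteq> 0"
    by (metis (no_types, lifting) atMost_iff sum.neutral)
  then have bk: "b k \<le> a + m" and nzf: "fps_nth (f k) (a + m - b k) \<noteq> 0"
    by (auto simp: fps_X_power_mult_nth split: if_splits)
  \<comment> \<open>The distance of \<open>k\<close> from the middle term of the sum; it takes both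
    signs and indexes the generalised pentagonal numbers.\<close>
  define i where "i = int n + 1 - int k"
  have 2: "2 * int (b k) = 2 * int a + 3 * i ^ 2 + i"
  proof -
    obtain d where d: "2 * Suc n = k + d" using k(1) by (auto simp: le_iff_add)
    have d': "int d = 2 * int n + 2 - int k" using arg_cong[OF d, of int] by simp
    have "2 * Suc n - k = d" using d by simp
    then have "2 * int (b k) = 3 * (2 * int (k choose 2)) + (3 * int n + 2) * (2 * int d)"
      by (simp add: b_def algebra_simps)
    moreover have "2 * int a = 3 * (2 * int (Suc n choose 2)) + (3 * int n + 2) * (2 * int (Suc n))"
      by (simp add: a_def algebra_simps)
    ultimately show ?thesis
      unfolding two_mult_choose_two d' i_def by (simp add: power2_eq_square algebra_simps)
  qed
  have "fps_X ^ (3 * Suc (min k (2 * Suc n - k))) dvd f k - 1"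
    unfolding f_def by (rule q_poch_mult_q_binomial) (use k(1) in auto)
  moreover have "a + m - b k < 3 * Suc (min k (2 * Suc n - k))"
  proof -
    have "int (2 * Suc n - k) = 2 * int n + 2 - int k" using k(1) by (simp add: of_nat_diff)
    then have "int (min k (2 * Suc n - k)) = min (int k) (2 * int n + 2 - int k)"
      by (simp only: of_nat_min)
    also have "\<dots> = int n + 1 - \<bar>i\<bar>"
      unfolding i_def by linarith
    finally have "int (min k (2 * Suc n - k)) = int n + 1 - \<bar>i\<bar>" .
    moreover have "6 * \<bar>i\<bar> - 6 < 3 * \<bar>i\<bar> ^ 2 + i"
    proof -
      \<comment> \<open>No integer lies strictly between 1 and 4/3. Expanded, this bounds
        \<open>3 i^2 - |i|\<close> below by \<open>6 |i| - 4\<close>.\<close>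
      have "0 \<le> (\<bar>i\<bar> - 1) * (3 * \<bar>i\<bar> - 4) "
        by (cases "\<bar>i\<bar> \<ge> 2") (auto intro!: mult_nonneg_nonneg mult_nonpos_nonpos)
      then show ?thesis by (simp add: algebra_simps power2_eq_square)
    qed
    moreover have "int (a + m - b k) = int a + int m - int (b k)" using bk by (simp add: of_nat_diff)
    moreover have "int m < 3 * int n + 3" using m by simp
    ultimately have "int (a + m - b k) < 3 * int (min k (2 * Suc n - k)) + 3"
      using 2 unfolding power2_abs by linarith
    moreover have "x < 3 * Suc y" if "int x < 3 * int y + 3" for x y
      using that by simp
    ultimately show ?thesis by blast
  qed
  ultimately have "a + m - b k = 0"
    using nzf fps_nth_if_X_power_dvd_diff_one[of _ "f k" "a + m - b k"] by metis
  then have "b k = a + m" using bk by linarith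
  then have "2 * int m = 3 * i ^ 2 + i" using 2 by simp
  moreover have "(6 * i + 1) ^ 2 = 12 * (3 * i ^ 2 + i) + 1"
    by (simp add: power2_eq_square algebra_simps)
  ultimately have "24 * int m + 1 = (6 * i + 1) ^ 2" by simp
  then show ?thesis by (rule that)
qed

section \<open>Congruences\<close>

text \<open>The valuation count for one term. Here \<open>c\<close> is 8 or 24, \<open>B\<close> is
  what remains of the quadratic form after removing \<open>p ^ (2 * u)\<close>, and \<open>u\<close>
  is capped at \<open>s\<close>. The valuation of \<open>M\<close> is \<open>2 * s - 1\<close> if
  \<open>u = s\<close> and \<open>2 * u\<close> otherwise.\<close>

lemma loc_dvd_mult_nth:
  assumes p: "prime p" and f: "loc_deriv_dvd p K f" and c: "\<not> p dvd c"
    and M: "c * int M = p ^ (2 * s - 1) * A - p ^ (2 * u) * B" and A: "\<not> p dvd A"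
    and s: "0 < s" "s \<le> Suc K" and u: "u \<le> s" "p ^ u dvd Y" "u < s \<Longrightarrow> \<not> p dvd B"
  shows "loc_dvd p (Suc K - s) (of_int Y * fps_nth f M)"
proof -
  obtain w M' where w: "c * int M = p ^ w * M'" "\<not> p dvd M'" "(Suc K - s) + w \<le> u + K"
  proof (cases "u = s")
    case True
    have "2 * s = Suc (2 * s - 1)" using s(1) by simp
    then have "p ^ (2 * s) = p ^ (2 * s - 1) * p" by (metis power_Suc2)
    then have "c * int M = p ^ (2 * s - 1) * (A - p * B)"
      using M True by (simp add: algebra_simps)
    moreover have "\<not> p dvd A - p * B" using A by (simp add: dvd_diff_left_iff)
    ultimately show ?thesis using that[of "2 * s - 1" "A - p * B"] s True by simp
  next
    case False
    then have us: "u < s" using u(1) by simp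
    then have "2 * s - 1 = 2 * u + Suc (2 * (s - u - 1))" by simp
    then have "p ^ (2 * s - 1) = p ^ (2 * u) * (p * p ^ (2 * (s - u - 1)))"
      by (simp add: power_add)
    then have "c * int M = p ^ (2 * u) * (p * (p ^ (2 * (s - u - 1)) * A) - B)"
      using M by (simp add: algebra_simps)
    moreover have "\<not> p dvd p * (p ^ (2 * (s - u - 1)) * A) - B"
      using u(3)[OF us] by (metis dvd_diff_right_iff dvd_triv_left)
    ultimately show ?thesis
      using that[of "2 * u" "p * (p ^ (2 * (s - u - 1)) * A) - B"] s us by simp
  qed
  have a: "loc_dvd p 0 (fps_nth f M)" "loc_dvd p K (of_nat M * fps_nth f M)"
    using f by (auto simp: loc_deriv_dvd_def)
  \<comment> \<open>If \<open>w > K\<close>, truncated subtraction makes this mere integrality, and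
    the factor \<open>p ^ u\<close> of \<open>Y\<close> alone suffices.\<close>
  have "loc_dvd p (K - w) (fps_nth f M)"
  proof (cases "w \<le> K")
    case True
    have "loc_dvd p K (of_int c * (of_nat M * fps_nth f M))"
      by (intro loc_dvd_mult_left loc_dvd_of_int a p) simp
    also have "of_int c * (of_nat M * fps_nth f M) = of_int (c * int M) * fps_nth f M" by simp
    also have "\<dots> = of_int (p ^ w) * (of_int M' * fps_nth f M)" unfolding w(1) by simp
    finally have "loc_dvd p (w + (K - w)) (of_int (p ^ w) * (of_int M' * fps_nth f M))"
      using True by simp
    then show ?thesis
      using loc_dvd_cancel_power loc_dvd_cancel_unit p w(2) by blast
  qed (use a in simp)
  then have "loc_dvd p (u + (K - w)) (of_int Y * fps_nth f M)"
    by (intro loc_dvd_mult loc_dvd_of_int p u(2))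
  then show ?thesis by (rule loc_dvd_mono) (use w(3) in linarith)
qed

section \<open>Reduction of \<open>p_coeff\<close> to single terms\<close>

lemma euler_factor_1_plus: "euler_factor (1 + t) i = (1 - fps_X ^ Suc i) * euler_factor t i"
proof -
  have "fps_nth (- (fps_X ^ Suc i) :: rat fps) 0 = 0" by simp
  then show ?thesis
    unfolding euler_factor_def fps_binomial_add_mult fps_binomial_1
    by (simp only: fps_compose_mult_distrib fps_compose_add_distrib fps_compose_1 fps_X_fps_compose_startby0
        add_uminus_conv_diff)
qed

text \<open>Any truncation beyond \<open>N\<close> gives the same coefficient. The free
  \<open>L\<close> is later \<open>Suc N\<close> for the cube and \<open>3 * Suc N\<close> for the
  fourth power.\<close>

lemma p_coeff_of_nat_plus:
  assumes "N < L"
  shows "p_coeff (of_nat d + t) N = fps_nth (q_poch fps_X L ^ d * (\<Prod>i<L. euler_factor t i)) N"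
proof -
  have e: "euler_factor (of_nat d + t) i = (1 - fps_X ^ Suc i) ^ d * euler_factor t i" for i
    by (induction d) (simp_all add: add.assoc euler_factor_1_plus mult.assoc del: power_Suc add: power_Suc[of "1 - _"])
  obtain L' where L: "L = Suc L'" using assms by (cases L) auto
  have "p_coeff (of_nat d + t) N = fps_nth (\<Prod>i<L. euler_factor (of_nat d + t) i) N"
    unfolding p_coeff_eq_partial_prod L lessThan_Suc_atMost
    by (rule euler_partial_prod_nth[symmetric]) (use assms L in simp)
  then show ?thesis
    unfolding e q_poch_def by (simp only: prod.distrib prod_power_distrib)
qed

lemma eight_mult_choose_two: "8 * int (Suc i choose 2) + 1 = int (2 * i + 1) ^ 2"
  using two_mult_choose_two[of "Suc i"] by (simp add: power2_eq_square algebra_simps)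

lemma loc_dvd_q_poch_cube_mult_nth:
  assumes p: "prime p" and "n \<le> L"
    and *: "\<And>i M. n = (Suc i choose 2) + M \<Longrightarrow> loc_dvd p e (of_int (int (2 * i + 1)) * fps_nth f M)"
  shows "loc_dvd p e (fps_nth (q_poch fps_X L ^ 3 * f) n)"
  unfolding fps_mult_nth
proof (rule loc_dvd_sum[OF p])
  fix m assume m: "m \<in> {0..n}"
  have "fps_nth (q_poch fps_X L ^ 3) m * fps_nth f (n - m) =
      (\<Sum>i\<le>L. (if m = Suc i choose 2 then (- 1) ^ i * of_nat (2 * i + 1) else 0) * fps_nth f (n - m))"
    unfolding sum_distrib_right[symmetric] using m assms(2) by (subst jacobi_nth[of m L]) auto
  also have "loc_dvd p e \<dots>"
  proof (rule loc_dvd_sum[OF p])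
    fix i
    show "loc_dvd p e ((if m = Suc i choose 2 then (- 1) ^ i * of_nat (2 * i + 1) else 0) * fps_nth f (n - m))"
    proof (cases "m = Suc i choose 2")
      case True
      then have "loc_dvd p e (of_int ((- 1) ^ i) * (of_int (int (2 * i + 1)) * fps_nth f (n - m)))"
        using m by (intro loc_dvd_mult_left loc_dvd_of_int p *) auto
      then show ?thesis using True by (simp add: mult.assoc)
    qed (use p in simp)
  qed
  finally show "loc_dvd p e (fps_nth (q_poch fps_X L ^ 3) m * fps_nth f (n - m))" .
qed

text \<open>The smaller of the two valuations, capped at \<open>s\<close>; the cap also covers
  \<open>x = y = 0\<close>.\<close>

lemma exists_common_power:
  fixes p x y :: int
  shows "\<exists>u\<le>s. p ^ u dvd x \<and> p ^ u dvd y \<and> (u < s \<longrightarrow> \<not> (p ^ Suc u dvd x \<and> p ^ Suc u dvd y))"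
proof (induction s)
  case (Suc s)
  then obtain u where "u \<le> s" "p ^ u dvd x" "p ^ u dvd y"
    "u < s \<longrightarrow> \<not> (p ^ Suc u dvd x \<and> p ^ Suc u dvd y)" by blast
  then show ?case
    by (cases "u = s \<and> p ^ Suc u dvd x \<and> p ^ Suc u dvd y")
      (blast, meson le_SucI le_neq_implies_less)
qed simp

lemma loc_dvd_p_coeff_3_plus:
  assumes p: "prime p" and "\<not> p dvd 8" and t: "loc_dvd p K t"
    and N: "8 * int N + 1 = p ^ (2 * s - 1) * A" "\<not> p dvd A" and s: "0 < s" "s \<le> Suc K"
  shows "loc_dvd p (Suc K - s) (p_coeff (3 + t) N)"
proof -
  define f where "f = (\<Prod>i<Suc N. euler_factor t i)"
  have f: "loc_deriv_dvd p K f"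
    unfolding f_def by (intro loc_deriv_dvd_prod loc_deriv_dvd_euler_factor p t)
  have "loc_dvd p (Suc K - s) (fps_nth (q_poch fps_X (Suc N) ^ 3 * f) N)"
  proof (rule loc_dvd_q_poch_cube_mult_nth[OF p])
    fix i M assume M: "N = (Suc i choose 2) + M"
    define Y where "Y = int (2 * i + 1)"
    obtain u where u: "u \<le> s" "p ^ u dvd Y" "u < s \<longrightarrow> \<not> p ^ Suc u dvd Y"
      using exists_common_power[of s p Y Y] by auto
    obtain y where y: "Y = p ^ u * y" using u(2) by blast
    have "8 * int M = p ^ (2 * s - 1) * A - Y ^ 2"
      using N(1) eight_mult_choose_two[of i] unfolding M Y_def by (simp only: of_nat_add distrib_left)
    then have M8: "8 * int M = p ^ (2 * s - 1) * A - p ^ (2 * u) * y ^ 2"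
      by (simp add: y power_mult_distrib mult.commute flip: power_mult)
    show "loc_dvd p (Suc K - s) (of_int (int (2 * i + 1)) * fps_nth f M)"
      unfolding Y_def[symmetric]
    proof (rule loc_dvd_mult_nth[OF p f assms(2) M8 N(2) s u(1,2)])
      assume "u < s"
      then have "\<not> p dvd y" using u(3) y by (auto simp: mult.commute)
      then show "\<not> p dvd y ^ 2" using p prime_dvd_power by blast
    qed
  qed simp
  then show ?thesis
    using p_coeff_of_nat_plus[of N "Suc N" 3 t] unfolding f_def by simp
qed

text \<open>The form is anisotropic modulo 5, because -3 is congruent to 2, which is not a square
  there.\<close>

lemma five_dvd_square_plus_three_square:
  fixes x y :: int
  assumes "5 dvd x ^ 2 + 3 * y ^ 2"
  shows "5 dvd x \<and> 5 dvd y"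
proof -
  have sq: "z ^ 2 mod 5 \<in> {0, 1, 4}" for z :: int
  proof -
    have "z mod 5 = 0 \<or> z mod 5 = 1 \<or> z mod 5 = 2 \<or> z mod 5 = 3 \<or> z mod 5 = 4" by presburger
    moreover have "z ^ 2 mod 5 = (z mod 5) ^ 2 mod 5" by (simp only: power_mod)
    ultimately show ?thesis by (elim disjE) simp_all
  qed
  have "5 dvd X \<and> 5 dvd Y"
    if "5 dvd X + 3 * Y" "X mod 5 \<in> {0, 1, 4}" "Y mod 5 \<in> {0, 1, 4}" for X Y :: int
    using that unfolding insert_iff empty_iff by presburger
  from this[OF assms sq sq] show ?thesis
    using prime_dvd_power[of "5 :: int" x 2] prime_dvd_power[of "5 :: int" y 2] by simp
qed

text \<open>In $24N + 4 = x^2 + 3y^2 + 24M$ the form $x^2 + 3y^2$ has even $5$-adic valuation,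
  since $5$ is inert in $\mathbb{Q}(\sqrt{-3})$.\<close>

lemma loc_dvd_p_coeff_4_plus:
  assumes t: "loc_dvd 5 K t"
    and N: "24 * int N + 4 = 5 ^ (2 * s - 1) * A" "\<not> 5 dvd A" and s: "0 < s" "s \<le> Suc K"
  shows "loc_dvd 5 (Suc K - s) (p_coeff (4 + t) N)"
proof -
  have p: "prime (5 :: int)" by simp
  \<comment> \<open>\<open>pentagonal_support\<close> concerns Pochhammer products whose length is a
    multiple of 3.\<close>
  define L where "L = 3 * Suc N"
  define q where "q = q_poch (fps_X :: rat fps) L"
  define f where "f = (\<Prod>i<L. euler_factor t i)"
  have f: "loc_deriv_dvd 5 K f"
    unfolding f_def by (intro loc_deriv_dvd_prod loc_deriv_dvd_euler_factor p t)
  \<comment> \<open>Reading \<open>q\<close> as the Euler product with exponent 1 shows that its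
    coefficients are 5-integral.\<close>
  have "euler_factor 1 i = 1 - fps_X ^ Suc i" for i
    using euler_factor_1_plus[of 0 i] by (simp add: euler_factor_def)
  then have "q = (\<Prod>i<L. euler_factor 1 i)" by (simp add: q_def q_poch_def)
  moreover have "loc_dvd 5 0 1" using loc_dvd_of_int[OF p, of 0 1] by simp
  ultimately have "loc_deriv_dvd 5 0 q"
    by (auto intro: loc_deriv_dvd_prod loc_deriv_dvd_euler_factor p)
  then have q: "loc_dvd 5 0 (fps_nth q i)" for i by (simp add: loc_deriv_dvd_def)
  have "loc_dvd 5 (Suc K - s) (fps_nth (q * (q ^ 3 * f)) N)"
    unfolding fps_mult_nth[of q]
  proof (rule loc_dvd_sum[OF p])
    fix j assume j: "j \<in> {0..N}"
    show "loc_dvd 5 (Suc K - s) (fps_nth q j * fps_nth (q ^ 3 * f) (N - j))"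
    proof (cases "fps_nth q j = 0")
      case False
      then obtain x where x: "24 * int j + 1 = x ^ 2"
        using pentagonal_support[of N j, where 'a = rat] j unfolding q_def L_def by auto
      have "loc_dvd 5 (Suc K - s) (fps_nth (q ^ 3 * f) (N - j))"
        unfolding q_def
      proof (rule loc_dvd_q_poch_cube_mult_nth[OF p])
        show "N - j \<le> L" by (simp add: L_def)
      next
        fix i M assume "N - j = (Suc i choose 2) + M"
        then have M: "N = j + (Suc i choose 2) + M" using j by auto
        define Y where "Y = int (2 * i + 1)"
        obtain u where u: "u \<le> s" "5 ^ u dvd x" "5 ^ u dvd Y"
            "u < s \<longrightarrow> \<not> (5 ^ Suc u dvd x \<and> 5 ^ Suc u dvd Y)"
          using exists_common_power[of s 5 x Y] by auto
        obtain x' y where xy: "x = 5 ^ u * x'" "Y = 5 ^ u * y" using u(2,3) by blast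
        have sq: "(5 ^ u * z) ^ 2 = 5 ^ (2 * u) * z ^ 2" for z :: int
          by (simp add: power_mult_distrib mult.commute flip: power_mult)
        \<comment> \<open>The constant 4 is shared out as 1 for the pentagonal square and 3 times 1
          for the Jacobi square.\<close>
        have "24 * int M = 24 * int N + 4 - (24 * int j + 1) - 3 * (8 * int (Suc i choose 2) + 1)"
          unfolding M of_nat_add by (simp only: algebra_simps)
        also have "\<dots> = 5 ^ (2 * s - 1) * A - (x ^ 2 + 3 * Y ^ 2)"
          unfolding eight_mult_choose_two x N(1) Y_def by (simp only: diff_diff_eq)
        finally have M24: "24 * int M = 5 ^ (2 * s - 1) * A - 5 ^ (2 * u) * (x' ^ 2 + 3 * y ^ 2)"
          unfolding xy sq by (simp only: distrib_left mult.left_commute)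
        show "loc_dvd 5 (Suc K - s) (of_int (int (2 * i + 1)) * fps_nth f M)"
          unfolding Y_def[symmetric]
        proof (rule loc_dvd_mult_nth[OF p f _ M24 N(2) s u(1,3)])
          assume "u < s"
          then have "\<not> (5 dvd x' \<and> 5 dvd y)" using u(4) xy by (auto simp: mult.commute)
          then show "\<not> 5 dvd x' ^ 2 + 3 * y ^ 2" using five_dvd_square_plus_three_square by blast
        qed simp
      qed
      then show ?thesis by (rule loc_dvd_mult_left[OF p q])
    qed (use p in simp)
  qed
  moreover have "q * (q ^ 3 * f) = q ^ 4 * f" by (simp add: power_numeral_reduce mult.assoc)
  moreover have "N < L" by (simp add: L_def)
  ultimately show ?thesis
    using p_coeff_of_nat_plus[of N L 4 t] unfolding f_def q_def by simp
qed

section \<open>The arithmetic progressions\<close>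

text \<open>Since \<open>p ^ 2\<close> is 1 modulo \<open>c\<close>, the division is exact and the
  added 1 completes \<open>p ^ (2 * s)\<close>. This exposes the odd exponent
  \<open>2 * s - 1\<close>.\<close>

lemma index_eq:
  fixes p c s n r :: nat
  assumes "p ^ 2 mod c = 1" "0 < c" "0 < s"
  shows "c * (p ^ (2 * s) * n + p ^ (2 * s - 1) * r + (p ^ (2 * s) - 1) div c) + 1 =
    p ^ (2 * s - 1) * (p + p * c * n + c * r)"
proof -
  have "p ^ (2 * s) mod c = ((p ^ 2 mod c) ^ s) mod c" by (simp add: power_mult power_mod)
  also have "\<dots> = 1" using assms(1) by (metis mod_mod_trivial power_one)
  finally have m: "p ^ (2 * s) mod c = 1" .
  then have "p ^ (2 * s) = c * (p ^ (2 * s) div c) + 1" by (metis mult_div_mod_eq)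
  then obtain d where d: "p ^ (2 * s) = c * d + 1" by blast
  have "c * ((p ^ (2 * s) - 1) div c) + 1 = p ^ (2 * s)" using assms(2) by (simp add: d)
  moreover have "p ^ (2 * s) = p ^ (2 * s - 1) * p"
    using assms(3) by (cases s) simp_all
  ultimately show ?thesis by (simp add: algebra_simps)
qed

text \<open>Modulo \<open>p\<close> the factor is \<open>c * r\<close>, so the exponent exposed by
  \<open>index_eq\<close> is the exact valuation.\<close>

lemma not_dvd_index_factor:
  fixes p c n r :: nat
  assumes "prime p" "\<not> p dvd c" "\<not> p dvd r"
  shows "\<not> int p dvd int (p + p * c * n + c * r)"
proof -
  have "\<not> p dvd c * r" using assms by (simp add: prime_dvd_mult_iff)
  then have "\<not> p dvd p * (1 + c * n) + c * r" by (simp add: dvd_add_right_iff)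
  then show ?thesis by (simp add: algebra_simps flip: of_nat_add of_nat_mult)
qed

lemma loc_dvd_power_divide:
  fixes p b :: nat
  assumes "prime p" "coprime b p" "b > 0"
  shows "loc_dvd (int p) K (- (of_nat p ^ K / of_nat b))"
  unfolding loc_dvd_def
proof (intro exI conjI)
  show "\<not> int p dvd int b"
    using assms by (metis coprime_common_divisor_nat dvd_refl int_dvd_int_iff not_prime_1 coprime_absorb_right not_prime_unit)
  show "of_int (int b) * - (of_nat p ^ K / of_nat b) = rat_of_int (int p ^ K * - 1)"
    using assms(3) by simp
qed

text \<open>Oddness of \<open>p\<close> suffices for the three cases 3, 5 and 7: it makes 8 a unit
  at \<open>p\<close> and \<open>p ^ 2\<close> congruent to 1 modulo 8.\<close>

lemma rat_cong_zero_p_coeff_3: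
  fixes p b n r s K :: nat
  assumes p: "prime p" "p \<noteq> 2" and b: "coprime b p" "b > 0" and r: "\<not> p dvd r" and s: "0 < s" "s \<le> Suc K"
    and t: "t = 3 - of_nat p ^ K / of_nat b"
  shows "rat_cong_zero (p_coeff t (p ^ (2 * s) * n + p ^ (2 * s - 1) * r + (p ^ (2 * s) - 1) div 8))
    (int p ^ (Suc K - s))"
proof (rule rat_cong_zero_if_loc_dvd)
  let ?N = "p ^ (2 * s) * n + p ^ (2 * s - 1) * r + (p ^ (2 * s) - 1) div 8"
  show "prime (int p)" using p by simp
  have p8: "\<not> p dvd 8"
  proof
    assume "p dvd 8"
    then have "p dvd 2 ^ 3" by simp
    then have "p dvd 2" using p(1) prime_dvd_power by blast
    then show False using p primes_dvd_imp_eq two_is_prime_nat by blast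
  qed
  have "odd p" using p primes_dvd_imp_eq two_is_prime_nat by blast
  then have "p mod 8 \<in> {1, 3, 5, 7}" by simp presburger
  moreover have "p ^ 2 mod 8 = (p mod 8) ^ 2 mod 8" by (simp add: power_mod)
  ultimately have p2: "p ^ 2 mod 8 = 1" by auto
  have "8 * int ?N + 1 = int (8 * ?N + 1)" by simp
  also have "8 * ?N + 1 = p ^ (2 * s - 1) * (p + p * 8 * n + 8 * r)"
    by (rule index_eq) (use p2 s in simp_all)
  also have "int \<dots> = int p ^ (2 * s - 1) * int (p + p * 8 * n + 8 * r)" by simp
  finally have N: "8 * int ?N + 1 = int p ^ (2 * s - 1) * int (p + p * 8 * n + 8 * r)" .
  have "\<not> int p dvd 8" using p8 by (metis int_dvd_int_iff of_nat_numeral)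
  then have "loc_dvd (int p) (Suc K - s) (p_coeff (3 + - (of_nat p ^ K / of_nat b)) ?N)"
    using p(1) by (intro loc_dvd_p_coeff_3_plus[OF _ _ loc_dvd_power_divide[OF p(1) b] N
        not_dvd_index_factor[OF p(1) p8 r] s]) simp_all
  then show "loc_dvd (int p) (Suc K - s) (p_coeff t ?N)" by (simp add: t)
qed

lemma rat_cong_zero_p_coeff_4:
  fixes b n r s K :: nat
  assumes b: "coprime b 5" "b > 0" and r: "\<not> 5 dvd r" and s: "0 < s" "s \<le> Suc K"
    and t: "t = 4 - 5 ^ K / of_nat b"
  shows "rat_cong_zero (p_coeff t (5 ^ (2 * s) * n + 5 ^ (2 * s - 1) * r + (5 ^ (2 * s) - 1) div 6))
    (5 ^ (Suc K - s))"
proof (rule rat_cong_zero_if_loc_dvd)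
  let ?N = "5 ^ (2 * s) * n + 5 ^ (2 * s - 1) * r + (5 ^ (2 * s) - 1) div 6 :: nat"
  show "prime (5 :: int)" by simp
  \<comment> \<open>The progression is governed by \<open>6 * ?N + 1\<close>; the factor 4, a unit
    at 5, produces the form required for the fourth power.\<close>
  have "24 * int ?N + 4 = 4 * int (6 * ?N + 1)" by simp
  also have "6 * ?N + 1 = 5 ^ (2 * s - 1) * (5 + 5 * 6 * n + 6 * r)"
    by (rule index_eq) (use s in simp_all)
  also have "4 * int \<dots> = 5 ^ (2 * s - 1) * (4 * int (5 + 5 * 6 * n + 6 * r))" by simp
  finally have N: "24 * int ?N + 4 = 5 ^ (2 * s - 1) * (4 * int (5 + 5 * 6 * n + 6 * r))" .
  have "\<not> 5 dvd int (5 + 5 * 6 * n + 6 * r)"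
    using not_dvd_index_factor[of 5 6 r n] r by simp
  then have A: "\<not> 5 dvd 4 * int (5 + 5 * 6 * n + 6 * r)" by presburger
  have "loc_dvd 5 K (- (5 ^ K / of_nat b))"
    using loc_dvd_power_divide[of 5 b K] b by simp
  then have "loc_dvd 5 (Suc K - s) (p_coeff (4 + - (5 ^ K / of_nat b)) ?N)"
    using N A s by (rule loc_dvd_p_coeff_4_plus)
  then show "loc_dvd 5 (Suc K - s) (p_coeff t ?N)" by (simp add: t)
qed

theorem theorem1p8:
  fixes k m s :: nat
  assumes "k > 0" and "m > 0" and "s > 0" and "s \<le> m + 1"
  shows
    "(\<forall>b::nat. b > 0 \<and> coprime b 3 \<longrightarrow>
        (\<forall>n::nat. \<forall>r\<in>{1, 2::nat}.
          rat_cong_zero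
            (p_coeff (- (3 ^ (k + m) - 3 * of_nat b) / of_nat b)
              (3 ^ (2 * s) * n + 3 ^ (2 * s - 1) * r + (3 ^ (2 * s) - 1) div 8))
            (3 ^ (k + m - s + 1)))) \<and>
     (\<forall>b::nat. b > 0 \<and> coprime b 5 \<longrightarrow>
        (\<forall>n::nat. \<forall>r\<in>{1, 2, 3, 4::nat}.
          rat_cong_zero
            (p_coeff (- (5 ^ (k + m) - 3 * of_nat b) / of_nat b)
              (5 ^ (2 * s) * n + 5 ^ (2 * s - 1) * r + (5 ^ (2 * s) - 1) div 8))
            (5 ^ (k + m - s + 1)))) \<and>
     (\<forall>b::nat. b > 0 \<and> coprime b 5 \<longrightarrow>
        (\<forall>n::nat. \<forall>r\<in>{1, 2, 3, 4::nat}.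
          rat_cong_zero
            (p_coeff (- (5 ^ (k + m) - 4 * of_nat b) / of_nat b)
              (5 ^ (2 * s) * n + 5 ^ (2 * s - 1) * r + (5 ^ (2 * s) - 1) div 6))
            (5 ^ (k + m - s + 1)))) \<and>
     (\<forall>b::nat. b > 0 \<and> coprime b 7 \<longrightarrow>
        (\<forall>n::nat. \<forall>r\<in>{1..6::nat}.
          rat_cong_zero
            (p_coeff (- (7 ^ (k + m) - 3 * of_nat b) / of_nat b)
              (7 ^ (2 * s) * n + 7 ^ (2 * s - 1) * r + (7 ^ (2 * s) - 1) div 8))
            (7 ^ (k + m - s + 1))))"
proof -
  \<comment> \<open>The earlier lemmas are used with \<open>K = k + m\<close>. The assumptions give
    \<open>s <= k + m\<close>, so the subtraction in the exponent is not truncated and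
    \<open>e\<close> holds.\<close>
  have s: "0 < s" "s \<le> Suc (k + m)" and e: "k + m - s + 1 = Suc (k + m) - s"
    using assms by simp_all
  have t: "- (of_nat p ^ (k + m) - d * of_nat b) / of_nat b = d - of_nat p ^ (k + m) / of_nat b"
    if "b > 0" for d :: rat and p b :: nat
    using that by (simp add: field_simps)
  have r: "\<not> q dvd r" if "0 < r" "r < q" for q r :: nat
    using that by (auto dest: dvd_imp_le)
  show ?thesis
    unfolding e
  proof (intro conjI allI impI ballI; elim conjE)
    fix b n r :: nat assume b: "b > 0" "coprime b 3" and "r \<in> {1, 2}"
    then have "\<not> 3 dvd r" by (intro r) auto
    show "rat_cong_zero (p_coeff (- (3 ^ (k + m) - 3 * of_nat b) / of_nat b)
        (3 ^ (2 * s) * n + 3 ^ (2 * s - 1) * r + (3 ^ (2 * s) - 1) div 8)) (3 ^ (Suc (k + m) - s))"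
      by (rule rat_cong_zero_p_coeff_3[of 3, OF _ _ b(2,1) \<open>\<not> 3 dvd r\<close> s t[OF b(1)], unfolded of_nat_numeral]) simp_all
  next
    fix b n r :: nat assume b: "b > 0" "coprime b 5" and "r \<in> {1, 2, 3, 4}"
    then have "\<not> 5 dvd r" by (intro r) auto
    show "rat_cong_zero (p_coeff (- (5 ^ (k + m) - 3 * of_nat b) / of_nat b)
        (5 ^ (2 * s) * n + 5 ^ (2 * s - 1) * r + (5 ^ (2 * s) - 1) div 8)) (5 ^ (Suc (k + m) - s))"
      by (rule rat_cong_zero_p_coeff_3[of 5, OF _ _ b(2,1) \<open>\<not> 5 dvd r\<close> s t[OF b(1)], unfolded of_nat_numeral]) simp_all
  next
    fix b n r :: nat assume b: "b > 0" "coprime b 5" and "r \<in> {1, 2, 3, 4}"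
    then have "\<not> 5 dvd r" by (intro r) auto
    show "rat_cong_zero (p_coeff (- (5 ^ (k + m) - 4 * of_nat b) / of_nat b)
        (5 ^ (2 * s) * n + 5 ^ (2 * s - 1) * r + (5 ^ (2 * s) - 1) div 6)) (5 ^ (Suc (k + m) - s))"
      by (rule rat_cong_zero_p_coeff_4[OF b(2,1) \<open>\<not> 5 dvd r\<close> s t[OF b(1), of 5, unfolded of_nat_numeral]])
  next
    fix b n r :: nat assume b: "b > 0" "coprime b 7" and "r \<in> {1..6}"
    then have "\<not> 7 dvd r" by (intro r) auto
    show "rat_cong_zero (p_coeff (- (7 ^ (k + m) - 3 * of_nat b) / of_nat b)
        (7 ^ (2 * s) * n + 7 ^ (2 * s - 1) * r + (7 ^ (2 * s) - 1) div 8)) (7 ^ (Suc (k + m) - s))"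
      by (rule rat_cong_zero_p_coeff_3[of 7, OF _ _ b(2,1) \<open>\<not> 7 dvd r\<close> s t[OF b(1)], unfolded of_nat_numeral]) simp_all
  qed
qed

end
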